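(* Let $G=(V,E)$ be a graph with $|E|=2|V|-1$. Then $G$ has an antistrong orientation if and only if (i) $|E(H)|\le 2|V(H)|-1$ for all nonempty subgraphs $H$ of $G$, and (ii) $|E(H)|\le 2|V(H)|-2$ for all nonempty bipartite subgraphs $H$ of $G$.
   Context: Graphs are finite and loopless; parallel edges may occur. An orientation of $G$ replaces each edge by an arc joining its ends. In a walk (in the underlying graph) of a digraph an arc $vw$ is forward if traversed from $v$ to $w$ and backward if traversed from $w$ to $v$. An antidirected trail is a walk with no repeated arc whose arcs alternate between forward and backward; it is a forward antidirected trail if it begins and ends with a forward arc. A digraph is antistrong if it has at least three vertices and contains a forward antidirected $(x,y)$-trail for every pair of distinct vertices $x,y$. *)

theory Defs
  imports "Graph_Theory.Digraph"
begin

section \<open>Finite loopless multigraphs\<close>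

record ('v, 'e) pre_multigraph =
  mverts :: "'v set"
  medges :: "'e set"
  mends :: "'e \<Rightarrow> 'v set"

text \<open>Edges are abstract objects, so parallel edges are possible. Having exactly two distinct
  ends excludes loops.\<close>

locale multigraph =
  fixes G :: "('v, 'e) pre_multigraph"
  assumes finite_mverts: "finite (mverts G)"
    and finite_medges: "finite (medges G)"
    and mends_in_mverts: "e \<in> medges G \<Longrightarrow> mends G e \<subseteq> mverts G"
    and card_mends: "e \<in> medges G \<Longrightarrow> card (mends G e) = 2"

definition submultigraph :: "('v, 'e) pre_multigraph \<Rightarrow> ('v, 'e) pre_multigraph \<Rightarrow> bool" where
  "submultigraph H G \<longleftrightarrow> multigraph H \<and> mverts H \<subseteq> mverts G \<and> medges H \<subseteq> medges G \<and>
     (\<forall>e\<in>medges H. mends H e = mends G e)"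

definition bipartite_multigraph :: "('v, 'e) pre_multigraph \<Rightarrow> bool" where
  "bipartite_multigraph G \<longleftrightarrow> (\<exists>A B. A \<union> B = mverts G \<and> A \<inter> B = {} \<and>
     (\<forall>e\<in>medges G. \<exists>a\<in>A. \<exists>b\<in>B. mends G e = {a, b}))"

definition is_orientation :: "('v, 'e) pre_digraph \<Rightarrow> ('v, 'e) pre_multigraph \<Rightarrow> bool" where
  "is_orientation D G \<longleftrightarrow> verts D = mverts G \<and> arcs D = medges G \<and>
     (\<forall>e\<in>medges G. {tail D e, head D e} = mends G e)"

lemma orientation_fin_loopfree_digraph:
  assumes "multigraph G" and "is_orientation D G"
  shows "fin_digraph D" and "loopfree_digraph D"
proof -
  interpret multigraph G by fact
  have ends: "{tail D e, head D e} = mends G e" if "e \<in> arcs D" for e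
    using assms(2) that by (auto simp: is_orientation_def)
  have in_G: "e \<in> medges G" if "e \<in> arcs D" for e
    using assms(2) that by (auto simp: is_orientation_def)
  interpret wf_digraph D
  proof
    fix e assume e: "e \<in> arcs D"
    have "{tail D e, head D e} \<subseteq> verts D"
      using ends[OF e] mends_in_mverts[OF in_G[OF e]] assms(2) by (simp add: is_orientation_def)
    then show "tail D e \<in> verts D" "head D e \<in> verts D" by auto
  qed
  show "fin_digraph D"
    using assms(2) finite_mverts finite_medges by unfold_locales (auto simp: is_orientation_def)
  show "loopfree_digraph D"
  proof
    fix e assume e: "e \<in> arcs D"
    show "tail D e \<noteq> head D e"
      using ends[OF e] card_mends[OF in_G[OF e]] by (metis card_2_iff doubleton_eq_iff insert_absorb2)
  qed
qed


section \<open>Antidirected trails\<close>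

text \<open>A step \<open>(v, a, w)\<close> of a walk in the underlying graph traverses the arc \<open>a\<close> from \<open>v\<close> to
  \<open>w\<close>, possibly against its direction. In a loopfree digraph, a step is not both forward and
  backward.\<close>

type_synonym ('v, 'e) step = "'v \<times> 'e \<times> 'v"

fun forward_step :: "('v, 'e) pre_digraph \<Rightarrow> ('v, 'e) step \<Rightarrow> bool" where
  "forward_step D (v, a, w) \<longleftrightarrow> a \<in> arcs D \<and> tail D a = v \<and> head D a = w"

fun backward_step :: "('v, 'e) pre_digraph \<Rightarrow> ('v, 'e) step \<Rightarrow> bool" where
  "backward_step D (v, a, w) \<longleftrightarrow> a \<in> arcs D \<and> tail D a = w \<and> head D a = v"

fun underlying_walk :: "('v, 'e) pre_digraph \<Rightarrow> 'v \<Rightarrow> ('v, 'e) step list \<Rightarrow> 'v \<Rightarrow> bool" where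
  "underlying_walk D x [] y \<longleftrightarrow> x = y \<and> x \<in> verts D"
| "underlying_walk D x ((v, a, w) # p) y \<longleftrightarrow>
     v = x \<and> (forward_step D (v, a, w) \<or> backward_step D (v, a, w)) \<and> underlying_walk D w p y"

definition antidirected_trail ::
  "('v, 'e) pre_digraph \<Rightarrow> 'v \<Rightarrow> ('v, 'e) step list \<Rightarrow> 'v \<Rightarrow> bool" where
  "antidirected_trail D x p y \<longleftrightarrow>
     underlying_walk D x p y \<and>
     distinct (map (\<lambda>(v, a, w). a) p) \<and>
     successively (\<lambda>s t. forward_step D s \<and> backward_step D t \<or>
                         backward_step D s \<and> forward_step D t) p"

definition forward_antidirected_trail ::
  "('v, 'e) pre_digraph \<Rightarrow> 'v \<Rightarrow> ('v, 'e) step list \<Rightarrow> 'v \<Rightarrow> bool" where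
  "forward_antidirected_trail D x p y \<longleftrightarrow>
     antidirected_trail D x p y \<and> p \<noteq> [] \<and> forward_step D (hd p) \<and> forward_step D (last p)"

definition antistrong :: "('v, 'e) pre_digraph \<Rightarrow> bool" where
  "antistrong D \<longleftrightarrow> card (verts D) \<ge> 3 \<and>
     (\<forall>x\<in>verts D. \<forall>y\<in>verts D. x \<noteq> y \<longrightarrow> (\<exists>p. forward_antidirected_trail D x p y))"

end

theory Submission
  imports Defs
begin

text \<open>Split every vertex \<open>v\<close> into a tail copy \<open>(v, False)\<close> and a head copy \<open>(v, True)\<close>, so that an
  arc \<open>vw\<close> becomes an edge from \<open>(v, False)\<close> to \<open>(w, True)\<close>. Forward antidirected \<open>(x, y)\<close>-trails
  are then trails from \<open>(x, False)\<close> to \<open>(y, True)\<close>, so a digraph on at least three vertices is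
  antistrong iff its split graph is connected; with \<open>2|V| - 1\<close> arcs this means that the split
  graph is a spanning tree, whence necessity by counting.

  For sufficiency, orienting an edge \<open>uv\<close> means choosing one of its two lifts to the bipartite double
  cover of \<open>G\<close>. By Rado's theorem for the graphic matroid, the choices can be made independent iff
  the lifts of every edge set \<open>J\<close> have rank at least \<open>|J|\<close>. This is checked on each component \<open>K\<close>
  of the double cover of \<open>J\<close>: it contains at most \<open>2|K| - 2\<close> lifts, by (i) if \<open>K\<close> is invariant
  under exchanging the two copies, and by (ii) otherwise, since then \<open>K\<close> is a copy of a bipartite
  subgraph.\<close>

section \<open>Rado's theorem\<close>

text \<open>Induction on the total size of the family. If some \<open>A k\<close> has two distinct
  elements, one of them can be deleted without breaking the rank condition; otherwise every
  \<open>A i\<close> is a singleton and the choice is forced.\<close>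

lemma rado_transversal:
  fixes r :: "'x set \<Rightarrow> int" and A :: "'i \<Rightarrow> 'x set"
  assumes "finite I" "finite U"
    and mono: "\<And>X Y. X \<subseteq> Y \<Longrightarrow> Y \<subseteq> U \<Longrightarrow> r X \<le> r Y"
    and submod: "\<And>X Y. X \<subseteq> U \<Longrightarrow> Y \<subseteq> U \<Longrightarrow> r (X \<union> Y) + r (X \<inter> Y) \<le> r X + r Y"
    and empty: "r {} = 0"
    and "\<And>i. i \<in> I \<Longrightarrow> A i \<subseteq> U"
    and "\<And>J. J \<subseteq> I \<Longrightarrow> int (card J) \<le> r (\<Union>i\<in>J. A i)"
  shows "\<exists>g. (\<forall>i\<in>I. g i \<in> A i) \<and> (\<forall>J\<subseteq>I. int (card J) \<le> r (g ` J))"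
  using assms(6,7)
proof (induction "\<Sum>i\<in>I. card (A i)" arbitrary: A rule: less_induct)
  case less
  note sub = less.prems(1) and rank = less.prems(2)
  show ?case
  proof (cases "\<exists>k\<in>I. \<exists>x\<in>A k. \<exists>y\<in>A k. x \<noteq> y")
    case False
    have "\<exists>x. A i = {x}" if "i \<in> I" for i
    proof -
      have "int (card {i}) \<le> r (\<Union>j\<in>{i}. A j)" using that by (intro rank) auto
      then have "A i \<noteq> {}" using empty by auto
      then show ?thesis using False that by blast
    qed
    then obtain g where g: "\<And>i. i \<in> I \<Longrightarrow> A i = {g i}" by metis
    have "(\<Union>i\<in>J. A i) = g ` J" if "J \<subseteq> I" for J using g that by auto
    then show ?thesis using g rank by (intro exI[of _ g]) auto
  next
    case True
    then obtain k x y where k: "k \<in> I" "x \<in> A k" "y \<in> A k" "x \<noteq> y" by blast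
    define B where "B z = A(k := A k - {z})" for z
    have finA: "finite (A i)" if "i \<in> I" for i using sub[OF that] \<open>finite U\<close> finite_subset by blast
    \<comment> \<open>A violation caused by deleting \<open>z\<close> must involve \<open>k\<close>.
      Dropping \<open>k\<close> from the violating index set lowers its size by one, which turns the
      strict inequality into \<le>.\<close>
    have tight: "\<exists>J\<subseteq>I - {k}. r ((A k - {z}) \<union> (\<Union>i\<in>J. A i)) \<le> int (card J)"
      if bad: "\<not> (\<forall>J\<subseteq>I. int (card J) \<le> r (\<Union>i\<in>J. B z i))" for z
    proof -
      obtain J where J: "J \<subseteq> I" "r (\<Union>i\<in>J. B z i) < int (card J)" using bad by (auto simp: not_le)
      have "k \<in> J"
      proof (rule ccontr)
        assume "k \<notin> J"
        then have "(\<Union>i\<in>J. B z i) = (\<Union>i\<in>J. A i)" by (auto simp: B_def)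
        then show False using J rank[of J] by simp
      qed
      then have "(\<Union>i\<in>J. B z i) = (A k - {z}) \<union> (\<Union>i\<in>J - {k}. A i)"
        by (auto simp: B_def split: if_splits)
      moreover have "int (card J) = int (card (J - {k})) + 1"
        using \<open>k \<in> J\<close> J(1) \<open>finite I\<close> by (metis card_Suc_Diff1 finite_subset of_nat_Suc add.commute)
      ultimately show ?thesis using J by (intro exI[of _ "J - {k}"]) auto
    qed
    have "\<exists>z\<in>{x, y}. \<forall>J\<subseteq>I. int (card J) \<le> r (\<Union>i\<in>J. B z i)"
    proof (rule ccontr)
      assume "\<not> ?thesis"
      then obtain P Q
        where P: "P \<subseteq> I - {k}" "r ((A k - {x}) \<union> (\<Union>i\<in>P. A i)) \<le> int (card P)"
          and Q: "Q \<subseteq> I - {k}" "r ((A k - {y}) \<union> (\<Union>i\<in>Q. A i)) \<le> int (card Q)"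
        using tight[of x] tight[of y] by auto
      \<comment> \<open>Uncrossing: as \<open>x\<close> and \<open>y\<close> differ,
        \<open>?X \<union> ?Y\<close> recovers all of \<open>A k\<close>, so its rank is at least
        \<open>card (P \<union> Q) + 1\<close>, while that of \<open>?X \<inter> ?Y\<close> is at
        least \<open>card (P \<inter> Q)\<close>. The sum exceeds \<open>card P + card Q\<close>,
        against submodularity.\<close>
      let ?X = "(A k - {x}) \<union> (\<Union>i\<in>P. A i)" and ?Y = "(A k - {y}) \<union> (\<Union>i\<in>Q. A i)"
      have XY: "?X \<subseteq> U" "?Y \<subseteq> U" using sub k(1) P(1) Q(1) by blast+
      have fin: "finite P" "finite Q" using P(1) Q(1) \<open>finite I\<close> by (meson finite_Diff finite_subset)+
      have "?X \<union> ?Y = (\<Union>i\<in>insert k (P \<union> Q). A i)" using k by auto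
      moreover have "int (card (insert k (P \<union> Q))) \<le> r (\<Union>i\<in>insert k (P \<union> Q). A i)"
        using P(1) Q(1) k(1) by (intro rank) auto
      moreover have "card (insert k (P \<union> Q)) = Suc (card (P \<union> Q))"
        using fin P(1) Q(1) by (intro card_insert_disjoint) auto
      ultimately have 1: "int (card (P \<union> Q)) + 1 \<le> r (?X \<union> ?Y)" by simp
      have "int (card (P \<inter> Q)) \<le> r (\<Union>i\<in>P \<inter> Q. A i)" using P(1) by (intro rank) auto
      also have "\<dots> \<le> r (?X \<inter> ?Y)" using XY by (intro mono) auto
      finally have 2: "int (card (P \<inter> Q)) \<le> r (?X \<inter> ?Y)" .
      show False
        using 1 2 P(2) Q(2) submod[OF XY] card_Un_Int[OF fin] by linarith
    qed
    then obtain z where z: "z \<in> A k" "\<And>J. J \<subseteq> I \<Longrightarrow> int (card J) \<le> r (\<Union>i\<in>J. B z i)"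
      using k by blast
    have BA: "B z i \<subseteq> A i" for i by (auto simp: B_def)
    have "(\<Sum>i\<in>I. card (B z i)) < (\<Sum>i\<in>I. card (A i))"
    proof (rule sum_strict_mono_ex1)
      show "\<forall>i\<in>I. card (B z i) \<le> card (A i)" using BA finA by (simp add: card_mono)
      have "card (B z k) < card (A k)"
        unfolding B_def fun_upd_same by (rule card_Diff1_less[OF finA[OF k(1)] z(1)])
      then show "\<exists>i\<in>I. card (B z i) < card (A i)" using k(1) by blast
    qed fact
    then have "\<exists>g. (\<forall>i\<in>I. g i \<in> B z i) \<and> (\<forall>J\<subseteq>I. int (card J) \<le> r (g ` J))"
      using BA sub z(2) by (intro less.hyps) blast+
    then show ?thesis using BA by blast
  qed
qed

section \<open>Connected components of a relation\<close>

definition conn :: "('a \<times> 'a) set \<Rightarrow> ('a \<times> 'a) set" where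
  "conn X = (X \<union> X\<inverse>)\<^sup>*"

text \<open>Isolated points of \<open>W\<close> count as components, so for \<open>X\<close> inside
  \<open>W \<times> W\<close> the difference \<open>card W - card (components W X)\<close> is the
  rank of \<open>X\<close> in the graphic matroid.\<close>

definition components :: "'a set \<Rightarrow> ('a \<times> 'a) set \<Rightarrow> 'a set set" where
  "components W X = (\<lambda>x. conn X `` {x}) ` W"

lemma equiv_conn: "equiv UNIV (conn X)"
  by (auto simp: conn_def equiv_def refl_on_def intro: sym_rtrancl sym_Un_converse trans_rtrancl)

lemma conn_refl [simp]: "(x, x) \<in> conn X"
  by (simp add: conn_def)

lemma conn_sym: "(x, y) \<in> conn X \<Longrightarrow> (y, x) \<in> conn X"
  using equiv_conn[of X] by (auto simp: equiv_def elim: symE)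

lemma conn_trans: "(x, y) \<in> conn X \<Longrightarrow> (y, z) \<in> conn X \<Longrightarrow> (x, z) \<in> conn X"
  using equiv_conn[of X] unfolding equiv_def trans_def by blast

lemma conn_edge: "(x, y) \<in> X \<Longrightarrow> (x, y) \<in> conn X"
  by (auto simp: conn_def)

lemma conn_mono: "X \<subseteq> Y \<Longrightarrow> conn X \<subseteq> conn Y"
  unfolding conn_def by (intro rtrancl_mono) auto

lemma conn_class_eq_iff: "conn X `` {x} = conn X `` {y} \<longleftrightarrow> (x, y) \<in> conn X"
  using equiv_class_eq_iff[OF equiv_conn, of x y X] by simp

lemma conn_invariant:
  assumes "(x, y) \<in> conn X" and "\<And>x y. (x, y) \<in> X \<Longrightarrow> f x = f y"
  shows "f x = f y"
  using assms(1) unfolding conn_def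
  by (induction rule: rtrancl_induct) (auto dest: assms(2))

lemma conn_closed:
  assumes "(x, y) \<in> conn X" "X \<subseteq> W \<times> W" "x \<in> W"
  shows "y \<in> W"
  using conn_invariant[OF assms(1), of "\<lambda>x. x \<in> W"] assms(2,3) by auto

text \<open>The new edge has to be crossed at most once, in one of its two directions: after
  crossing it both ways a walk is back in the old class it left.\<close>

lemma conn_insert:
  "(x, y) \<in> conn (insert (a, b) X) \<longleftrightarrow> (x, y) \<in> conn X \<or>
     (x, a) \<in> conn X \<and> (b, y) \<in> conn X \<or> (x, b) \<in> conn X \<and> (a, y) \<in> conn X"
proof -
  have "insert (a, b) X \<union> (insert (a, b) X)\<inverse> = insert (a, b) (insert (b, a) (X \<union> X\<inverse>))" by auto
  then have "(x, y) \<in> conn (insert (a, b) X) \<longleftrightarrow>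
      (x, y) \<in> (insert (a, b) (insert (b, a) (X \<union> X\<inverse>)))\<^sup>*"
    by (simp add: conn_def)
  then show ?thesis
    unfolding rtrancl_insert conn_def[symmetric]
    using conn_trans[of x a X y] conn_trans[of x b X y] by auto
qed

section \<open>Number of components when edges are added\<close>

lemma finite_components: "finite W \<Longrightarrow> finite (components W X)"
  by (simp add: components_def)

lemma components_insert_same:
  assumes "(a, b) \<in> conn X"
  shows "components W (insert (a, b) X) = components W X"
proof -
  have "(x, y) \<in> conn (insert (a, b) X) \<longleftrightarrow> (x, y) \<in> conn X" for x y
    using assms conn_sym[OF assms] conn_trans[of x a X b] conn_trans[of x b X y]
      conn_trans[of x b X a] conn_trans[of x a X y]
    by (auto simp: conn_insert)
  then have "conn (insert (a, b) X) = conn X" by auto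
  then show ?thesis by (simp add: components_def)
qed

lemma card_components_insert:
  assumes "(a, b) \<notin> conn X" "finite W" "a \<in> W" "b \<in> W"
  shows "card (components W X) = Suc (card (components W (insert (a, b) X)))"
proof -
  define c where "c x = conn X `` {x}" for x
  have conn_iff: "(x, y) \<in> conn X \<longleftrightarrow> c x = c y" for x y
    by (simp add: c_def conn_class_eq_iff)
  have mem: "y \<in> c x \<longleftrightarrow> c x = c y" for x y by (simp add: c_def conn_class_eq_iff)
  have ab: "c a \<noteq> c b" using assms(1) by (simp add: conn_iff)
  have new: "conn (insert (a, b) X) `` {x} = (if c x \<in> {c a, c b} then c a \<union> c b else c x)" for x
    by (intro set_eqI) (simp add: conn_insert conn_iff mem, metis)
  have old: "components W X = c ` W" by (simp add: components_def c_def)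
  have "components W (insert (a, b) X) = insert (c a \<union> c b) (c ` W - {c a, c b})"
    using assms(3) by (force simp: components_def new)
  \<comment> \<open>The merged class is new, since an old class containing both \<open>a\<close> and
    \<open>b\<close> would make \<open>c a\<close> and \<open>c b\<close> equal. Hence inserting it
    adds exactly one to the count.\<close>
  moreover have "c a \<union> c b \<notin> c ` W"
  proof
    assume "c a \<union> c b \<in> c ` W"
    then obtain x where "c a \<union> c b = c x" by blast
    moreover have "a \<in> c a \<union> c b" "b \<in> c a \<union> c b" by (simp_all add: mem)
    ultimately show False using ab by (simp add: mem)
  qed
  ultimately have "card (components W (insert (a, b) X)) = Suc (card (c ` W - {c a, c b}))"
    using assms(2) by simp
  moreover have "card (c ` W - {c a, c b}) = card (c ` W) - 2"
    using assms ab by (subst card_Diff_subset) auto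
  \<comment> \<open>This keeps the subtraction of 2 above from truncating at 0.\<close>
  moreover have "card {c a, c b} \<le> card (c ` W)" using assms(2-4) by (intro card_mono) auto
  ultimately show ?thesis using ab by (simp add: old)
qed

lemma card_components_insert_le:
  assumes "finite W" "a \<in> W" "b \<in> W"
  shows "card (components W (insert (a, b) X)) \<le> card (components W X)"
    and "card (components W X) \<le> Suc (card (components W (insert (a, b) X)))"
proof -
  have "card (components W X) = card (components W (insert (a, b) X)) \<or>
      card (components W X) = Suc (card (components W (insert (a, b) X)))"
    using card_components_insert[OF _ assms] components_insert_same by metis
  then show "card (components W (insert (a, b) X)) \<le> card (components W X)"
    and "card (components W X) \<le> Suc (card (components W (insert (a, b) X)))"
    by linarith+
qed

text \<open>Supermodularity, in the diminishing-returns form: adding \<open>F\<close> merges at least as many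
  components of the smaller relation \<open>Z\<close> as of \<open>Y\<close>.\<close>

lemma card_components_Un:
  assumes "finite W" "finite F" "F \<subseteq> W \<times> W" "Z \<subseteq> Y"
  shows "card (components W Y) + card (components W (Z \<union> F))
    \<le> card (components W Z) + card (components W (Y \<union> F))"
  using assms(2,3)
proof (induction rule: finite_induct)
  case (insert e F)
  obtain a b where e: "e = (a, b)" by fastforce
  then have ab: "a \<in> W" "b \<in> W" using insert.prems by auto
  \<comment> \<open>An edge that merges nothing over \<open>Z \<union> F\<close> merges nothing over
    \<open>Y \<union> F\<close> either; this excludes the one bad case among the four below.\<close>
  have "conn (Z \<union> F) \<subseteq> conn (Y \<union> F)" using assms(4) by (intro conn_mono) auto
  then have "card (components W (Y \<union> F)) + card (components W (insert e (Z \<union> F)))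
    \<le> card (components W (Z \<union> F)) + card (components W (insert e (Y \<union> F)))"
    using card_components_insert[OF _ assms(1) ab] components_insert_same[of a b _ W]
      card_components_insert_le[OF assms(1) ab, of "Z \<union> F"]
    unfolding e by (cases "(a, b) \<in> conn (Z \<union> F)"; cases "(a, b) \<in> conn (Y \<union> F)") auto
  then show ?case using insert by simp
qed simp

lemma card_components_antimono:
  assumes "finite W" "X \<subseteq> Y" "Y \<subseteq> W \<times> W"
  shows "card (components W Y) \<le> card (components W X)"
proof -
  have "finite Y" using assms(1,3) by (meson finite_SigmaI finite_subset)
  from card_components_Un[OF assms(1) this assms(3,2)] show ?thesis
    using assms(2) by (simp add: Un_absorb1)
qed

lemma card_components_Un_le:
  assumes "finite W" "finite F" "F \<subseteq> W \<times> W"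
  shows "card (components W X) \<le> card (components W (X \<union> F)) + card F"
  using assms(2,3)
proof (induction rule: finite_induct)
  case (insert e F)
  then obtain a b where "e = (a, b)" "a \<in> W" "b \<in> W" by auto
  then show ?case
    using insert card_components_insert_le(2)[OF assms(1), of a b "X \<union> F"] by simp
qed simp

text \<open>A labelling constant along edges factors through the components, via any choice of
  representatives. It serves as a certificate for many components.\<close>

lemma card_image_le_components:
  assumes "finite W" and "\<And>x y. (x, y) \<in> X \<Longrightarrow> f x = f y"
  shows "card (f ` W) \<le> card (components W X)"
proof -
  have rep: "f (SOME y. y \<in> conn X `` {x}) = f x" for x
  proof -
    have "(SOME y. y \<in> conn X `` {x}) \<in> conn X `` {x}" by (rule someI[of _ x]) simp
    then show ?thesis using conn_invariant[of x _ X f] assms(2) by simp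
  qed
  have "(\<lambda>C. f (SOME y. y \<in> C)) ` components W X = f ` W"
    unfolding components_def image_image rep ..
  then show ?thesis using assms(1) by (metis card_image_le finite_components)
qed

lemma card_components_eq_1_iff:
  "card (components W X) = 1 \<longleftrightarrow> W \<noteq> {} \<and> (\<forall>x\<in>W. \<forall>y\<in>W. (x, y) \<in> conn X)"
proof
  assume "card (components W X) = 1"
  then obtain C where C: "components W X = {C}" by (auto simp: card_1_singleton_iff)
  then have "conn X `` {x} = C" if "x \<in> W" for x using that by (auto simp: components_def)
  moreover have "W \<noteq> {}" using C by (auto simp: components_def)
  ultimately show "W \<noteq> {} \<and> (\<forall>x\<in>W. \<forall>y\<in>W. (x, y) \<in> conn X)"
    by (auto simp flip: conn_class_eq_iff)
next
  assume r: "W \<noteq> {} \<and> (\<forall>x\<in>W. \<forall>y\<in>W. (x, y) \<in> conn X)"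
  then obtain x where "x \<in> W" by blast
  moreover have "conn X `` {y} = conn X `` {x}" if "y \<in> W" for y
    using r that \<open>x \<in> W\<close> by (simp add: conn_class_eq_iff)
  ultimately have "components W X = {conn X `` {x}}" unfolding components_def by blast
  then show "card (components W X) = 1" by simp
qed

lemma sum_card_components:
  assumes "finite W" "X \<subseteq> W \<times> W"
  shows "(\<Sum>C\<in>components W X. card C) = card W"
proof -
  have sub: "C \<subseteq> W" if "C \<in> components W X" for C
    using that conn_closed[OF _ assms(2)] by (auto simp: components_def)
  have "\<Union> (components W X) = W"
    using sub by (auto simp: components_def)
  moreover have "pairwise disjnt (components W X)"
  proof -
    have meet: "(x, y) \<in> conn X" if "(x, z) \<in> conn X" "(y, z) \<in> conn X" for x y z
      using conn_trans[OF that(1) conn_sym[OF that(2)]] .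
    then show ?thesis
      by (auto simp: components_def pairwise_def disjnt_def conn_class_eq_iff)
  qed
  ultimately show ?thesis
    using card_Union_disjoint[of "components W X"] finite_subset[OF sub assms(1)] by simp
qed

text \<open>The images of edges need only be connected, so \<open>f\<close> may reverse edges, as
  the exchange of the two vertex copies does later.\<close>

lemma conn_map:
  assumes "(x, y) \<in> conn X" and "\<And>x y. (x, y) \<in> X \<Longrightarrow> (f x, f y) \<in> conn X"
  shows "(f x, f y) \<in> conn X"
  using assms(1) unfolding conn_def[of X]
proof (induction rule: rtrancl_induct)
  case (step y z)
  then have "(f y, f z) \<in> conn X" using assms(2)[of y z] conn_sym[OF assms(2)[of z y]] by auto
  then show ?case using step.IH conn_trans[of "f x" "f y" X "f z"] by (simp add: conn_def)
qed simp

lemma components_empty: "components W {} = (\<lambda>x. {x}) ` W"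
  by (auto simp: components_def conn_def)

lemma graphic_transversal:
  fixes A :: "'i \<Rightarrow> ('a \<times> 'a) set"
  assumes "finite I" "finite W"
    and "\<And>i. i \<in> I \<Longrightarrow> A i \<subseteq> W \<times> W"
    and "\<And>J. J \<subseteq> I \<Longrightarrow> card J + card (components W (\<Union>i\<in>J. A i)) \<le> card W"
  shows "\<exists>g. (\<forall>i\<in>I. g i \<in> A i) \<and> card I + card (components W (g ` I)) \<le> card W"
proof -
  let ?r = "\<lambda>X. int (card W) - int (card (components W X))"
  have "\<exists>g. (\<forall>i\<in>I. g i \<in> A i) \<and> (\<forall>J\<subseteq>I. int (card J) \<le> ?r (g ` J))"
  proof (rule rado_transversal[where U = "W \<times> W"])
    fix X Y :: "('a \<times> 'a) set" assume XY: "X \<subseteq> W \<times> W" "Y \<subseteq> W \<times> W"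
    have "finite Y" using assms(2) XY(2) by (meson finite_SigmaI finite_subset)
    \<comment> \<open>Submodularity is diminishing returns for adding \<open>Y\<close> to
      \<open>X \<inter> Y\<close> and to \<open>X\<close>.\<close>
    then have "card (components W X) + card (components W (X \<inter> Y \<union> Y))
      \<le> card (components W (X \<inter> Y)) + card (components W (X \<union> Y))"
      using card_components_Un[OF assms(2), of Y "X \<inter> Y" X] XY(2) by simp
    then show "?r (X \<union> Y) + ?r (X \<inter> Y) \<le> ?r X + ?r Y" by (simp add: Un_absorb1)
  next
    fix J assume "J \<subseteq> I"
    then show "int (card J) \<le> ?r (\<Union>i\<in>J. A i)" using assms(4)[of J] by simp
  qed (use assms card_components_antimono in \<open>auto simp: components_empty card_image\<close>)
  then obtain g where g: "\<forall>i\<in>I. g i \<in> A i" "\<forall>J\<subseteq>I. int (card J) \<le> ?r (g ` J)" by blast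
  have "int (card I) \<le> ?r (g ` I)" using g(2) by blast
  then show ?thesis using g(1) by (intro exI[of _ g]) auto
qed

section \<open>Antidirected trails as walks in the bipartite representation\<close>

definition arc_lift :: "('v, 'e) pre_digraph \<Rightarrow> 'e \<Rightarrow> ('v \<times> bool) \<times> ('v \<times> bool)" where
  "arc_lift D e = ((tail D e, False), (head D e, True))"

text \<open>The Boolean tells which copy of a vertex the walk is at: it leaves tail copies forward
  and head copies backward, so alternation is built in.\<close>

fun split_walk ::
  "('v, 'e) pre_digraph \<Rightarrow> 'v \<times> bool \<Rightarrow> ('v, 'e) step list \<Rightarrow> 'v \<times> bool \<Rightarrow> bool" where
  "split_walk D (x, b) [] z \<longleftrightarrow> (x, b) = z \<and> x \<in> verts D"
| "split_walk D (x, b) ((v, a, w) # p) z \<longleftrightarrow> v = x \<and>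
     (if b then backward_step D (v, a, w) else forward_step D (v, a, w)) \<and>
     split_walk D (w, \<not> b) p z"

abbreviation trail_arcs :: "('v, 'e) step list \<Rightarrow> 'e list" where
  "trail_arcs p \<equiv> map (\<lambda>(v, a, w). a) p"

abbreviation alternating :: "('v, 'e) pre_digraph \<Rightarrow> ('v, 'e) step list \<Rightarrow> bool" where
  "alternating D p \<equiv> successively (\<lambda>s t. forward_step D s \<and> backward_step D t \<or>
                                       backward_step D s \<and> forward_step D t) p"

lemma split_walk_antidirected:
  assumes "split_walk D (x, b) p (y, True)"
  shows "underlying_walk D x p y \<and> alternating D p \<and>
    (p \<noteq> [] \<longrightarrow> (if b then backward_step D (hd p) else forward_step D (hd p)) \<and>
       forward_step D (last p))"
  using assms
proof (induction p arbitrary: x b)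
  case (Cons s p)
  obtain v a w where s: "s = (v, a, w)" by (metis prod_cases3)
  have "split_walk D (w, \<not> b) p (y, True)" using Cons.prems by (simp add: s)
  note IH = Cons.IH[OF this]
  show ?case
  proof (cases p)
    case Nil
    then show ?thesis using Cons.prems s by (auto split: if_splits)
  next
    case (Cons t q)
    then show ?thesis using IH Cons.prems s by (cases b) auto
  qed
qed simp

text \<open>Without loops no step is both forward and backward, so the direction of the first step
  fixes all later ones and the final forward step must end at a head copy.\<close>

lemma antidirected_split_walk:
  assumes "loopfree_digraph D" "underlying_walk D x p y" "alternating D p"
    and "p \<noteq> []" "if b then backward_step D (hd p) else forward_step D (hd p)"
    and "forward_step D (last p)"
  shows "split_walk D (x, b) p (y, True)"
  using assms(2-)
proof (induction p arbitrary: x b)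
  case (Cons s p)
  obtain v a w where s: "s = (v, a, w)" by (metis prod_cases3)
  have excl: "\<not> (forward_step D t \<and> backward_step D t)" for t
    by (cases t) (metis backward_step.simps forward_step.simps loopfree_digraph.no_loops[OF assms(1)])
  show ?case
  proof (cases p)
    case Nil
    then have "\<not> b" using Cons.prems excl[of s] by auto
    then show ?thesis using Nil Cons.prems s by auto
  next
    case p: (Cons t q)
    have "if \<not> b then backward_step D t else forward_step D t"
      using Cons.prems p excl[of s] by (auto split: if_splits)
    then have "split_walk D (w, \<not> b) p (y, True)"
      using Cons.prems p s by (intro Cons.IH) auto
    then show ?thesis using Cons.prems(1,4) s by (cases b) simp_all
  qed
qed simp

lemma forward_antidirected_trail_iff:
  assumes "loopfree_digraph D"
  shows "forward_antidirected_trail D x p y \<longleftrightarrow>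
    split_walk D (x, False) p (y, True) \<and> distinct (trail_arcs p)"
proof -
  have "p \<noteq> []" if "split_walk D (x, False) p (y, True)" using that by (cases p) auto
  then show ?thesis
    using split_walk_antidirected[of D x False p y] antidirected_split_walk[OF assms, of x p y False]
    unfolding forward_antidirected_trail_def antidirected_trail_def by auto
qed

section \<open>Trails and connectivity in the split graph\<close>

lemma split_walk_conn:
  "split_walk D s p z \<Longrightarrow> (s, z) \<in> conn (arc_lift D ` arcs D)"
proof (induction D s p z rule: split_walk.induct)
  case (2 D x b v a w p z)
  then have "a \<in> arcs D" by (auto split: if_splits)
  then have "(arc_lift D a) \<in> conn (arc_lift D ` arcs D)"
    by (metis conn_edge image_eqI surj_pair)
  then have "((x, b), (w, \<not> b)) \<in> conn (arc_lift D ` arcs D)"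
    using 2(2) by (cases b) (auto simp: arc_lift_def intro: conn_sym)
  then show ?case using 2 by (auto intro: conn_trans)
qed simp

lemma split_walk_append:
  "split_walk D s (p @ q) z \<Longrightarrow> \<exists>t. split_walk D t q z"
  by (induction D s p z rule: split_walk.induct) auto

lemma conn_split_trail:
  assumes "(s, z) \<in> conn (arc_lift D ` arcs D)" "fst z \<in> verts D"
  shows "\<exists>p. split_walk D s p z \<and> distinct (trail_arcs p)"
  using assms(1) unfolding conn_def
proof (induction rule: converse_rtrancl_induct)
  case base
  then show ?case using assms(2) by (intro exI[of _ "[]"]) (cases z; auto)
next
  case (step s t)
  obtain p where p: "split_walk D t p z" "distinct (trail_arcs p)" using step.IH by blast
  obtain a where a: "a \<in> arcs D" "arc_lift D a = (s, t) \<or> arc_lift D a = (t, s)"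
    using step.hyps(1) by (metis UnE converseE image_iff prod.inject)
  show ?case
  proof (cases "a \<in> set (trail_arcs p)")
    case False
    have "split_walk D s ((fst s, a, fst t) # p) z"
      using a p(1) by (auto simp: arc_lift_def)
    then show ?thesis using p(2) False by (intro exI[of _ "(fst s, a, fst t) # p"]) auto
  next
    case True
    \<comment> \<open>The walk already traverses \<open>a\<close>, so it visits \<open>s\<close> just before or just after doing so.\<close>
    then obtain v w where "(v, a, w) \<in> set p" by auto
    then obtain p1 p2 where p12: "p = p1 @ (v, a, w) # p2" by (meson split_list)
    then obtain x b where w: "split_walk D (x, b) ((v, a, w) # p2) z"
      using split_walk_append[of D t p1] p(1) by (metis surj_pair)
    have "s = (x, b) \<or> s = (w, \<not> b)"
      using w a by (cases b) (auto simp: arc_lift_def)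
    then have "split_walk D s ((v, a, w) # p2) z \<or> split_walk D s p2 z" using w by auto
    moreover have "distinct (trail_arcs ((v, a, w) # p2))" "distinct (trail_arcs p2)"
      using p(2) p12 by auto
    ultimately show ?thesis by blast
  qed
qed

lemma antistrong_iff_connected:
  assumes "loopfree_digraph D"
  shows "antistrong D \<longleftrightarrow> card (verts D) \<ge> 3 \<and>
    card (components (verts D \<times> UNIV) (arc_lift D ` arcs D)) = 1"
proof -
  let ?C = "conn (arc_lift D ` arcs D)"
  have trail: "(\<exists>p. forward_antidirected_trail D x p y) \<longleftrightarrow> ((x, False), (y, True)) \<in> ?C"
    if "y \<in> verts D" for x y
    using forward_antidirected_trail_iff[OF assms] split_walk_conn conn_split_trail[of _ "(y, True)"] that
    by (metis fst_conv)
  show ?thesis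
  proof
    assume a: "antistrong D"
    have r: "((x, False), (y, True)) \<in> ?C" if "x \<in> verts D" "y \<in> verts D" "x \<noteq> y" for x y
      using a that trail by (auto simp: antistrong_def)
    have c: "card (verts D) \<ge> 3" using a by (simp add: antistrong_def)
    \<comment> \<open>Antistrongness says nothing about \<open>x\<close> paired with itself. Two
      further vertices give the detour \<open>(x, False)\<close>, \<open>(y, True)\<close>,
      \<open>(z, False)\<close>, \<open>(x, True)\<close>; this is where three vertices are
      used.\<close>
    have loop: "((x, False), (x, True)) \<in> ?C" if x: "x \<in> verts D" for x
    proof -
      have "2 \<le> card (verts D - {x})" using c x by (simp add: card_Diff_singleton)
      then obtain T where T: "T \<subseteq> verts D - {x}" "card T = 2"
        by (meson obtain_subset_with_card_n)
      then obtain y z where "T = {y, z}" "y \<noteq> z" by (meson card_2_iff)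
      then have yz: "y \<in> verts D" "z \<in> verts D" "x \<noteq> y" "z \<noteq> x" "z \<noteq> y" using T(1) by auto
      show ?thesis
        using conn_trans[OF r[OF x yz(1,3)] conn_trans[OF conn_sym[OF r[OF yz(2,1,5)]] r[OF yz(2) x yz(4)]]] .
    qed
    have FT: "((x, False), (y, True)) \<in> ?C" if "x \<in> verts D" "y \<in> verts D" for x y
      using r loop that by (cases "x = y") auto
    have "((x, b), (x, c)) \<in> ?C" if "x \<in> verts D" for x b c
      using loop[OF that] conn_sym[OF loop[OF that]] by (cases b; cases c) auto
    then have "((x, b), (y, c)) \<in> ?C" if "x \<in> verts D" "y \<in> verts D" for x y b c
      using FT that by (meson conn_trans)
    moreover have "verts D \<noteq> {}" using c by auto
    ultimately show "card (verts D) \<ge> 3 \<and>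
        card (components (verts D \<times> UNIV) (arc_lift D ` arcs D)) = 1"
      using c by (auto simp: card_components_eq_1_iff simp del: One_nat_def)
  next
    assume "card (verts D) \<ge> 3 \<and>
        card (components (verts D \<times> UNIV) (arc_lift D ` arcs D)) = 1"
    then show "antistrong D"
      using trail by (auto simp: card_components_eq_1_iff antistrong_def simp del: One_nat_def)
  qed
qed

section \<open>Necessity\<close>

lemma antistrong_orientation_sparse:
  assumes "multigraph G" "is_orientation D G" "antistrong D"
    and "card (medges G) + 1 = 2 * card (mverts G)"
    and "J \<subseteq> medges G"
    and "\<And>e. e \<in> J \<Longrightarrow> f (tail D e, False) = f (head D e, True)"
  shows "card J + card (f ` (mverts G \<times> UNIV)) \<le> 2 * card (mverts G)"
proof -
  let ?W = "mverts G \<times> (UNIV :: bool set)" and ?X = "\<lambda>J. arc_lift D ` J"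
  interpret fin_digraph D using orientation_fin_loopfree_digraph(1)[OF assms(1,2)] .
  have D: "verts D = mverts G" "arcs D = medges G" using assms(2) by (auto simp: is_orientation_def)
  have fin: "finite (mverts G)" "finite (medges G)" using assms(1) by (auto simp: multigraph_def)
  have "card (components ?W (?X (medges G))) = 1"
    using assms(3) antistrong_iff_connected[OF orientation_fin_loopfree_digraph(2)[OF assms(1,2)]] D
    by simp
  moreover have "card (components ?W (?X J))
    \<le> card (components ?W (?X J \<union> ?X (medges G - J))) + card (?X (medges G - J))"
    using fin D tail_in_verts head_in_verts by (intro card_components_Un_le) (auto simp: arc_lift_def)
  moreover have "?X J \<union> ?X (medges G - J) = ?X (medges G)" using assms(5) by auto
  moreover have "card (?X (medges G - J)) \<le> card (medges G) - card J"
    using fin assms(5) card_image_le[of "medges G - J" "arc_lift D"]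
    by (metis card_Diff_subset finite_Diff finite_subset)
  moreover have "card J \<le> card (medges G)" using fin assms(5) by (intro card_mono)
  moreover have "card (f ` ?W) \<le> card (components ?W (?X J))"
    using fin assms(6) by (intro card_image_le_components) (auto simp: arc_lift_def)
  ultimately show ?thesis using assms(4) by simp
qed

lemma antistrong_orientation_counts:
  fixes G H :: "('v, 'e) pre_multigraph"
  assumes "multigraph G" "is_orientation D G" "antistrong D"
    and "card (medges G) + 1 = 2 * card (mverts G)"
    and "submultigraph H G" "mverts H \<noteq> {}"
  shows "card (medges H) + 1 \<le> 2 * card (mverts H)"
    and "bipartite_multigraph H \<Longrightarrow> card (medges H) + 2 \<le> 2 * card (mverts H)"
proof -
  let ?V = "mverts G" and ?S = "mverts H" and ?J = "medges H"
  have fin: "finite ?V" using assms(1) by (auto simp: multigraph_def)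
  have sub: "?S \<subseteq> ?V" "?J \<subseteq> medges G" using assms(5) by (auto simp: submultigraph_def)
  have ends: "mends H e = {tail D e, head D e}" if "e \<in> ?J" for e
    using that assms(2,5) sub(2) by (auto simp: is_orientation_def submultigraph_def)
  then have ends_S: "tail D e \<in> ?S \<and> head D e \<in> ?S" if "e \<in> ?J" for e
    using that assms(5) by (fastforce simp: submultigraph_def multigraph_def)
  note sparse = antistrong_orientation_sparse[OF assms(1-4) sub(2)]
  have diff: "card ?V = card (?V - ?S) + card ?S"
    using fin sub(1) by (metis card_Diff_subset card_mono finite_subset le_add_diff_inverse2)
  show "card ?J + 1 \<le> 2 * card ?S"
  proof -
    \<comment> \<open>All copies of vertices of \<open>H\<close> share one label and every other
      split vertex keeps its own.\<close>
    define f where "f p = (if fst p \<in> ?S then None else Some p)" for p :: "'v \<times> bool"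
    have "f ` (?V \<times> UNIV) = insert None (Some ` ((?V - ?S) \<times> UNIV))"
      using sub(1) assms(6) by (force simp: f_def)
    then have "card (f ` (?V \<times> UNIV)) = 1 + 2 * card (?V - ?S)"
      using fin by (simp add: card_image card_insert_if)
    moreover have "card ?J + card (f ` (?V \<times> UNIV)) \<le> 2 * card ?V"
      using ends_S by (intro sparse) (simp add: f_def)
    ultimately show ?thesis using diff by simp
  qed
  show "card ?J + 2 \<le> 2 * card ?S" if bip: "bipartite_multigraph H"
  proof -
    from bip obtain A B where AB: "A \<union> B = ?S" "A \<inter> B = {}"
      and ends_AB: "\<forall>e\<in>?J. \<exists>a\<in>A. \<exists>b\<in>B. mends H e = {a, b}"
      unfolding bipartite_multigraph_def by (elim exE conjE) (rule that)
    \<comment> \<open>Bipartiteness allows two labels on \<open>H\<close>: tail copies of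
      \<open>A\<close> go with head copies of \<open>B\<close>, and head copies of \<open>A\<close>
      with tail copies of \<open>B\<close>. The second label improves the bound by one.\<close>
    define f where "f = (\<lambda>(v, b). if v \<in> ?S then Inl ((v \<in> A) = b) else Inr (v, b))"
    have "f ` (?V \<times> UNIV) = UNIV <+> ((?V - ?S) \<times> UNIV)"
    proof (intro set_eqI iffI)
      fix z :: "bool + 'v \<times> bool"
      assume z: "z \<in> UNIV <+> ((?V - ?S) \<times> UNIV)"
      obtain s where s: "s \<in> ?S" using assms(6) by blast
      from z show "z \<in> f ` (?V \<times> UNIV)"
      proof (elim PlusE)
        fix c assume "z = Inl c"
        then have "z = f (s, (s \<in> A) = c)" using s by (auto simp: f_def)
        then show ?thesis using s sub(1) by blast
      next
        fix p assume p: "p \<in> (?V - ?S) \<times> (UNIV :: bool set)" "z = Inr p"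
        then have "z = f p" by (auto simp: f_def)
        then show ?thesis using p by blast
      qed
    qed (auto simp: f_def)
    then have "card (f ` (?V \<times> UNIV)) = 2 + 2 * card (?V - ?S)"
      using fin by (simp add: card_Plus)
    moreover have "f (tail D e, False) = f (head D e, True)" if "e \<in> ?J" for e
    proof -
      have "tail D e \<in> A \<longleftrightarrow> head D e \<notin> A"
        using AB(2) bspec[OF ends_AB that] ends[OF that] by (auto simp: doubleton_eq_iff)
      then show ?thesis using ends_S[OF that] by (simp add: f_def)
    qed
    then have "card ?J + card (f ` (?V \<times> UNIV)) \<le> 2 * card ?V" by (rule sparse)
    ultimately show ?thesis using diff by simp
  qed
qed

section \<open>Sufficiency\<close>

text \<open>The unordered pair of ends matches \<open>{u, v}\<close> in both orders, so both
  orientations of \<open>e\<close> occur.\<close>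

definition lifts :: "('v, 'e) pre_multigraph \<Rightarrow> 'e \<Rightarrow> (('v \<times> bool) \<times> ('v \<times> bool)) set" where
  "lifts G e = {((u, False), (v, True)) | u v. mends G e = {u, v}}"

lemma card_lifts:
  assumes "card (mends G e) = 2"
  shows "finite (lifts G e)" "card (lifts G e) = 2"
proof -
  obtain u v where "mends G e = {u, v}" "u \<noteq> v" using assms by (auto simp: card_2_iff)
  then have "lifts G e = {((u, False), (v, True)), ((v, False), (u, True))}"
    by (auto simp: lifts_def doubleton_eq_iff)
  then show "finite (lifts G e)" "card (lifts G e) = 2" using \<open>u \<noteq> v\<close> by simp_all
qed

lemma card_lifts_component:
  fixes G :: "('v, 'e) pre_multigraph"
  assumes G: "multigraph G" and J: "J \<subseteq> medges G"
    and sparse: "\<And>H :: ('v, 'e) pre_multigraph. submultigraph H G \<Longrightarrow> mverts H \<noteq> {} \<Longrightarrow>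
      card (medges H) + 1 \<le> 2 * card (mverts H)"
    and bip_sparse: "\<And>H :: ('v, 'e) pre_multigraph. submultigraph H G \<Longrightarrow> mverts H \<noteq> {} \<Longrightarrow>
      bipartite_multigraph H \<Longrightarrow> card (medges H) + 2 \<le> 2 * card (mverts H)"
    and K: "K \<in> components (mverts G \<times> UNIV) (\<Union>e\<in>J. lifts G e)"
  shows "card {(e, p). e \<in> J \<and> p \<in> lifts G e \<and> fst p \<in> K} + 2 \<le> 2 * card K"
proof -
  interpret multigraph G by fact
  define X where "X = (\<Union>e\<in>J. lifts G e)"
  define L where "L = {(e, p). e \<in> J \<and> p \<in> lifts G e \<and> fst p \<in> K}"
  define S where "S = fst ` K"
  define F where "F = fst ` L"
  \<comment> \<open>\<open>H\<close> is the projection of \<open>K\<close> to \<open>G\<close>: its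
    edges are those of \<open>J\<close> with at least one lift in \<open>K\<close>.\<close>
  define H :: "('v, 'e) pre_multigraph" where "H = \<lparr>mverts = S, medges = F, mends = mends G\<rparr>"
  have lifts_card: "finite (lifts G e)" "card (lifts G e) = 2" if "e \<in> J" for e
    using card_lifts[OF card_mends[of e]] J that by auto
  have XW: "X \<subseteq> (mverts G \<times> UNIV) \<times> (mverts G \<times> UNIV)"
    using mends_in_mverts J by (fastforce simp: X_def lifts_def)
  obtain k where k: "k \<in> mverts G \<times> UNIV" "K = conn X `` {k}"
    using K by (auto simp: components_def X_def)
  have KW: "K \<subseteq> mverts G \<times> UNIV" using k conn_closed[OF _ XW] by auto
  have finK: "finite K" using finite_subset[OF KW] finite_mverts by simp
  have finJ: "finite J" using J finite_medges finite_subset by blast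
  have L_sub: "L \<subseteq> (SIGMA e:F. lifts G e)" by (force simp: L_def F_def)
  have FJ: "F \<subseteq> J" by (auto simp: F_def L_def)
  have finF: "finite F" using FJ finJ finite_subset by blast
  have ends: "\<exists>u v. mends G e = {u, v} \<and> (u, False) \<in> K \<and> (v, True) \<in> K" if e: "e \<in> F" for e
  proof -
    obtain u v where uv: "e \<in> J" "mends G e = {u, v}" "(u, False) \<in> K"
      using e by (auto simp: F_def L_def lifts_def)
    then have "((u, False), (v, True)) \<in> X" by (auto simp: X_def lifts_def)
    then have "(v, True) \<in> K" using uv(3) k(2) by (auto intro: conn_trans conn_edge)
    then show ?thesis using uv by blast
  qed
  have "mends G e \<subseteq> S" if e: "e \<in> F" for e
    using ends[OF e] by (force simp: S_def)
  moreover have "S \<subseteq> mverts G" using KW by (auto simp: S_def)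
  ultimately have H: "submultigraph H G"
    using FJ J card_mends finF finK
    by (auto simp: submultigraph_def multigraph_def H_def S_def)
  have "k \<in> K" using k(2) by simp
  then have "S \<noteq> {}" by (auto simp: S_def)
  then have H_ne: "mverts H \<noteq> {}" by (simp add: H_def)

  define flip :: "'v \<times> bool \<Rightarrow> 'v \<times> bool" where "flip = (\<lambda>(v, b). (v, \<not> b))"
  have flip_conn: "(flip p, flip q) \<in> conn X" if "(p, q) \<in> conn X" for p q
  proof (rule conn_map[OF that])
    fix p q assume "(p, q) \<in> X"
    then obtain e u v where "e \<in> J" "mends G e = {v, u}" "p = (u, False)" "q = (v, True)"
      by (auto simp: X_def lifts_def)
    \<comment> \<open>Exchanging the copies turns a lift into the reversal of the other lift of the
      same edge, so it preserves connectivity.\<close>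
    then have "(flip q, flip p) \<in> X" by (auto simp: X_def lifts_def flip_def)
    then show "(flip p, flip q) \<in> conn X" by (intro conn_sym[OF conn_edge])
  qed
  show ?thesis
  proof (cases "(k, flip k) \<in> conn X")
    case True
    \<comment> \<open>Here \<open>K\<close> is invariant under \<open>flip\<close>, so it has two
      points per vertex of \<open>H\<close> and at most two lifts per edge: twice condition (i) is
      the claim.\<close>
    have opp: "(v, \<not> b) \<in> K" if "(v, b) \<in> K" for v b
      using that flip_conn[of k "(v, b)"] True k(2) conn_trans[of k "flip k" X]
      by (simp add: flip_def)
    have "(v, c) \<in> K" if "(v, b) \<in> K" for v b c
      using that opp[OF that] by (cases b; cases c) auto
    then have "K = S \<times> UNIV" by (force simp: S_def)
    then have "card K = 2 * card S" by (simp add: card_cartesian_product)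
    moreover have "card L \<le> 2 * card F"
    proof -
      have "card L \<le> card (SIGMA e:F. lifts G e)"
        using L_sub finF FJ lifts_card(1) by (intro card_mono) auto
      also have "\<dots> = 2 * card F" using finF FJ lifts_card by (simp add: subset_iff)
      finally show ?thesis .
    qed
    moreover have "card F + 1 \<le> 2 * card S" using sparse[OF H H_ne] by (simp add: H_def)
    ultimately show ?thesis by (simp add: L_def)
  next
    case False
    \<comment> \<open>Here \<open>K\<close> holds at most one copy of each vertex. Both lifts of one
      edge would supply both copies of its ends, so lifts in \<open>K\<close> match edges of
      \<open>H\<close>; the copy present in \<open>K\<close> gives the bipartition, and (ii)
      applies.\<close>
    have excl: "(v, \<not> b) \<notin> K" if "(v, b) \<in> K" for v b
      using that flip_conn[of k "(v, b)"] False k(2) conn_trans[of k "(v, \<not> b)" X "flip k"]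
      by (auto simp: flip_def dest: conn_sym)
    have "inj_on fst K"
    proof (rule inj_onI)
      fix p q assume "p \<in> K" "q \<in> K" "fst p = fst q"
      then show "p = q" using excl[of "fst p" "snd p"]
        by (cases p; cases q; cases "snd p"; cases "snd q") auto
    qed
    then have "card K = card S" by (simp add: S_def card_image)
    moreover have "inj_on fst L"
    proof (rule inj_onI)
      fix s t assume s: "s \<in> L" and t: "t \<in> L" and eq: "fst s = fst t"
      obtain e u v where e: "s = (e, (u, False), (v, True))" "mends G e = {u, v}" "(u, False) \<in> K" "e \<in> F"
        using s by (force simp: L_def F_def lifts_def)
      obtain u' v' where e': "t = (e, (u', False), (v', True))" "mends G e = {u', v'}" "(u', False) \<in> K"
        using t eq e(1) by (auto simp: L_def lifts_def)
      have "(v, True) \<in> K" using ends[OF e(4)] e(2,3) excl[of v True] excl[of u False]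
        by (auto simp: doubleton_eq_iff)
      then have "u' \<noteq> v" using excl[of v True] e'(3) by auto
      then show "s = t" using e e' by (auto simp: doubleton_eq_iff)
    qed
    then have "card L = card F" by (simp add: F_def card_image)
    moreover have "bipartite_multigraph H"
      unfolding bipartite_multigraph_def
    proof (intro exI conjI ballI)
      show "{v. (v, False) \<in> K} \<union> {v. (v, True) \<in> K} = mverts H"
      proof -
        have "v \<in> S \<longleftrightarrow> (\<exists>b. (v, b) \<in> K)" for v by (force simp: S_def)
        then show ?thesis by (auto simp: H_def ex_bool_eq)
      qed
      show "{v. (v, False) \<in> K} \<inter> {v. (v, True) \<in> K} = {}" using excl[of _ False] by auto
      show "\<exists>a\<in>{v. (v, False) \<in> K}. \<exists>b\<in>{v. (v, True) \<in> K}. mends H e = {a, b}"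
        if "e \<in> medges H" for e
        using ends[of e] that by (auto simp: H_def)
    qed
    then have "card F + 2 \<le> 2 * card S" using bip_sparse[OF H H_ne] by (simp add: H_def)
    ultimately show ?thesis by (simp add: L_def)
  qed
qed

text \<open>Each edge of \<open>J\<close> has two lifts and each lift lies in one component, so
  summing \<open>card_lifts_component\<close> over all components bounds \<open>2 * card J\<close>;
  halving gives the rank condition.\<close>

lemma lifts_rank:
  fixes G :: "('v, 'e) pre_multigraph"
  assumes G: "multigraph G" and J: "J \<subseteq> medges G"
    and "\<And>H :: ('v, 'e) pre_multigraph. submultigraph H G \<Longrightarrow> mverts H \<noteq> {} \<Longrightarrow>
      card (medges H) + 1 \<le> 2 * card (mverts H)"
    and "\<And>H :: ('v, 'e) pre_multigraph. submultigraph H G \<Longrightarrow> mverts H \<noteq> {} \<Longrightarrow>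
      bipartite_multigraph H \<Longrightarrow> card (medges H) + 2 \<le> 2 * card (mverts H)"
  shows "card J + card (components (mverts G \<times> UNIV) (\<Union>e\<in>J. lifts G e)) \<le> card (mverts G \<times> (UNIV :: bool set))"
proof -
  interpret multigraph G by fact
  let ?W = "mverts G \<times> (UNIV :: bool set)"
  define X where "X = (\<Union>e\<in>J. lifts G e)"
  define L where "L K = {(e, p). e \<in> J \<and> p \<in> lifts G e \<and> fst p \<in> K}" for K
  have finJ: "finite J" using J finite_medges finite_subset by blast
  have finW: "finite ?W" using finite_mverts by simp
  have XW: "X \<subseteq> ?W \<times> ?W" using mends_in_mverts J by (fastforce simp: X_def lifts_def)
  have "finite (lifts G e)" "card (lifts G e) = 2" if "e \<in> J" for e
    using card_lifts[OF card_mends[of e]] J that by auto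
  then have "2 * card J = card (SIGMA e:J. lifts G e)" using finJ by simp
  also have "(SIGMA e:J. lifts G e) = (\<Union>K\<in>components ?W X. L K)"
  proof (intro equalityI subsetI)
    fix s assume "s \<in> (SIGMA e:J. lifts G e)"
    then obtain e p where s: "s = (e, p)" "e \<in> J" "p \<in> lifts G e" by blast
    then have "fst p \<in> ?W" using XW by (auto simp: X_def)
    then have "conn X `` {fst p} \<in> components ?W X" by (simp add: components_def)
    moreover have "s \<in> L (conn X `` {fst p})" using s by (simp add: L_def)
    ultimately show "s \<in> (\<Union>K\<in>components ?W X. L K)" by blast
  qed (auto simp: L_def)
  also have "card \<dots> \<le> (\<Sum>K\<in>components ?W X. card (L K))"
    by (intro card_UN_le finite_components finW)
  finally have "2 * card J + 2 * card (components ?W X) \<le> (\<Sum>K\<in>components ?W X. card (L K) + 2)"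
    unfolding sum.distrib by simp
  also have "\<dots> \<le> (\<Sum>K\<in>components ?W X. 2 * card K)"
    unfolding L_def X_def by (intro sum_mono card_lifts_component assms)
  also have "\<dots> = 2 * card ?W"
    using sum_card_components[OF finW XW] by (simp add: sum_distrib_left[symmetric])
  finally show ?thesis by (simp add: X_def)
qed

text \<open>With at most two vertices, all edges are parallel, so \<open>G\<close> is bipartite and
  has one edge too many for (ii).\<close>

lemma three_le_card_mverts:
  assumes "multigraph G" and "card (medges G) + 1 = 2 * card (mverts G)"
    and bip: "bipartite_multigraph G \<Longrightarrow> mverts G \<noteq> {} \<Longrightarrow>
      card (medges G) + 2 \<le> 2 * card (mverts G)"
  shows "3 \<le> card (mverts G)"
proof (rule ccontr)
  interpret multigraph G by fact
  assume "\<not> 3 \<le> card (mverts G)"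
  then have le: "card (mverts G) \<le> 2" by simp
  \<comment> \<open>By parity: without edges, 1 would equal
    \<open>2 * card (mverts G)\<close>.\<close>
  have "medges G \<noteq> {}" using assms(2) by auto
  then obtain e where e: "e \<in> medges G" by blast
  then have 2: "card (mverts G) = 2"
    using le card_mono[OF finite_mverts mends_in_mverts[OF e]] card_mends[OF e] by simp
  then obtain a b where ab: "mverts G = {a, b}" "a \<noteq> b" by (auto simp: card_2_iff)
  have "mends G e = {a} \<union> {b}" if "e \<in> medges G" for e
    using card_subset_eq[OF finite_mverts mends_in_mverts[OF that]] card_mends[OF that] 2 ab by auto
  then have "bipartite_multigraph G"
    unfolding bipartite_multigraph_def using ab by (intro exI[of _ "{a}"] exI[of _ "{b}"]) auto
  then show False using bip ab assms(2) by simp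
qed

lemma antistrong_orientation_exists:
  fixes G :: "('v, 'e) pre_multigraph"
  assumes G: "multigraph G" and card: "card (medges G) + 1 = 2 * card (mverts G)"
    and sparse: "\<And>H :: ('v, 'e) pre_multigraph. submultigraph H G \<Longrightarrow> mverts H \<noteq> {} \<Longrightarrow>
      card (medges H) + 1 \<le> 2 * card (mverts H)"
    and bip_sparse: "\<And>H :: ('v, 'e) pre_multigraph. submultigraph H G \<Longrightarrow> mverts H \<noteq> {} \<Longrightarrow>
      bipartite_multigraph H \<Longrightarrow> card (medges H) + 2 \<le> 2 * card (mverts H)"
  shows "\<exists>D. is_orientation D G \<and> antistrong D"
proof -
  interpret multigraph G by fact
  let ?W = "mverts G \<times> (UNIV :: bool set)"
  have finW: "finite ?W" using finite_mverts by simp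
  have "\<exists>g. (\<forall>e\<in>medges G. g e \<in> lifts G e) \<and>
      card (medges G) + card (components ?W (g ` medges G)) \<le> card ?W"
  proof (rule graphic_transversal[OF finite_medges finW])
    show "lifts G e \<subseteq> ?W \<times> ?W" if "e \<in> medges G" for e
      using mends_in_mverts[OF that] by (auto simp: lifts_def)
  qed (rule lifts_rank[OF G _ sparse bip_sparse])
  then obtain g where g: "\<And>e. e \<in> medges G \<Longrightarrow> g e \<in> lifts G e"
    and comps: "card (medges G) + card (components ?W (g ` medges G)) \<le> card ?W"
    by blast
  define D where "D = \<lparr>verts = mverts G, arcs = medges G,
    tail = \<lambda>e. fst (fst (g e)), head = \<lambda>e. fst (snd (g e))\<rparr>"
  have D: "verts D = mverts G" "arcs D = medges G" by (simp_all add: D_def)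
  have lift: "arc_lift D e = g e" "{tail D e, head D e} = mends G e" if e: "e \<in> medges G" for e
  proof -
    obtain u v where "g e = ((u, False), (v, True))" "mends G e = {u, v}"
      using g[OF e] by (auto simp: lifts_def)
    then show "arc_lift D e = g e" "{tail D e, head D e} = mends G e"
      by (simp_all add: arc_lift_def D_def)
  qed
  have orient: "is_orientation D G" using lift(2) by (simp add: is_orientation_def D)
  have three: "3 \<le> card (mverts G)"
  proof (rule three_le_card_mverts[OF G card])
    have "submultigraph G G" using G by (simp add: submultigraph_def)
    then show "card (medges G) + 2 \<le> 2 * card (mverts G)"
      if "bipartite_multigraph G" "mverts G \<noteq> {}" using bip_sparse that by blast
  qed
  \<comment> \<open>The double cover has \<open>2 * card (mverts G)\<close> vertices, one more than
    \<open>G\<close> has edges, so a full-rank choice of lifts leaves at most one component.\<close>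
  have "card (components ?W (g ` medges G)) \<le> 1"
    using comps card by (simp add: card_cartesian_product)
  moreover have "components ?W (g ` medges G) \<noteq> {}"
    using three by (auto simp: components_def)
  ultimately have "card (components ?W (g ` medges G)) = 1"
    using finite_components[OF finW] by (metis card_gt_0_iff le_antisym Suc_leI One_nat_def)
  moreover have "arc_lift D ` arcs D = g ` medges G" using lift(1) by (auto simp: D)
  ultimately have "antistrong D"
    using antistrong_iff_connected[OF orientation_fin_loopfree_digraph(2)[OF G orient]] three
    by (simp add: D)
  then show ?thesis using orient by blast
qed

theorem theorem6p2:
  fixes G :: "('v, 'e) pre_multigraph"
  assumes "multigraph G"
    and "int (card (medges G)) = 2 * int (card (mverts G)) - 1"
  shows "(\<exists>D. is_orientation D G \<and> antistrong D) \<longleftrightarrow>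
    (\<forall>H. submultigraph H G \<and> mverts H \<noteq> {} \<longrightarrow>
       int (card (medges H)) \<le> 2 * int (card (mverts H)) - 1) \<and>
    (\<forall>H. submultigraph H G \<and> mverts H \<noteq> {} \<and> bipartite_multigraph H \<longrightarrow>
       int (card (medges H)) \<le> 2 * int (card (mverts H)) - 2)"
proof -
  have card: "card (medges G) + 1 = 2 * card (mverts G)" using assms(2) by linarith
  have int_iff: "int m \<le> 2 * int n - 1 \<longleftrightarrow> m + 1 \<le> 2 * n" "int m \<le> 2 * int n - 2 \<longleftrightarrow> m + 2 \<le> 2 * n"
    for m n by linarith+
  show ?thesis
    unfolding int_iff
    using antistrong_orientation_counts[OF assms(1) _ _ card]
      antistrong_orientation_exists[OF assms(1) card]
    by metis
qed

end
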